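(* Let $n$ be a positive integer and $\theta>0$. For every integer $m$ with $2\le m\le n$, $$|R_{\theta,n;m}|=\frac{(\tilde a\alpha_1+u^2\tilde b)\,[-(b+\tau_{-1}u)\alpha_1]^{m-2}-(\tilde a\alpha_2+u^2\tilde b)\,[-(b+\tau_{-1}u)\alpha_2]^{m-2}}{\alpha_1-\alpha_2},$$ where $$a=1-2u^2+u^4-2u^2w+2u^4w,\qquad b=2u^2-u^4+w-u^4w-1,$$ $$\tilde a=1-u^2-2u^2w-u^2w^2,\qquad \tilde b=u^2+w+u^2w-1,$$ $$\alpha_1=\frac{-(a-2\tau_{-1}u)-\sqrt{(a-2\tau_{-1}u)^2-4\tau_{-1}u(b+\tau_{-1}u)}}{2(b+\tau_{-1}u)},\qquad \alpha_2=\frac{-(a-2\tau_{-1}u)+\sqrt{(a-2\tau_{-1}u)^2-4\tau_{-1}u(b+\tau_{-1}u)}}{2(b+\tau_{-1}u)}.$$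
   Context: Notation: $w=\theta/n$, $u=e^{-w}$, $\tau_{-1}=(w-1)u+(1+w)u^3$. For $1\le m\le n$, $R_{\theta,n;m}$ is the $m\times m$ matrix with $(i,j)$th element $(1+|i-j|w)u^{|i-j|}$, $1\le i,j\le m$. $|M|$ denotes the determinant of a matrix $M$. *)

theory Defs
  imports Complex_Main "Jordan_Normal_Form.Determinant"
begin

text \<open>Rows and columns are indexed from 0; as the entries depend only on the difference
  of the two indices, this is the same matrix as with indices from 1 to \<open>m\<close>.\<close>

definition R_mat :: "real \<Rightarrow> nat \<Rightarrow> nat \<Rightarrow> real mat" where
  "R_mat \<theta> n m =
    (let w = \<theta> / real n; u = exp (- w)
     in mat m m (\<lambda>(i, j). let d = nat \<bar>int i - int j\<bar> in (1 + real d * w) * u ^ d))"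

end

theory Submission
  imports Defs
begin

text \<open>
  The entry \<open>(1 + d w) u^d\<close> at distance \<open>d\<close> from the diagonal is a solution of the linear
  recurrence with characteristic polynomial \<open>(z - u)\<^sup>2\<close>. Read the matrix as the covariance matrix
  of variables \<open>x\<^sub>1, x\<^sub>2, \<dots>\<close> and pass to \<open>y\<^sub>1 = x\<^sub>1\<close>, \<open>y\<^sub>2 = x\<^sub>2\<close> and
  \<open>y\<^sub>i = x\<^sub>i - 2 u x\<^sub>i\<^sub>-\<^sub>1 + u\<^sup>2 x\<^sub>i\<^sub>-\<^sub>2\<close> for \<open>i \<ge> 3\<close>. The change of variables is unitriangular, so it
  keeps the determinant (\<open>det_ar_filter\<close>); and since the covariances satisfy the recurrence,
  \<open>y\<^sub>i\<close> is uncorrelated with \<open>x\<^sub>j\<close>, hence with \<open>y\<^sub>j\<close>, whenever \<open>j \<le> i - 2\<close>. The covariance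
  matrix of the \<open>y\<^sub>i\<close> is therefore tridiagonal. Beyond its first two rows its diagonal and
  subdiagonal entries are constant, namely \<open>a - 2 \<tau> u\<close> and \<open>\<tau>\<close>, so expansion along the last row gives
  (\<open>det_toeplitz_recurrence\<close>) for the determinants \<open>D\<^sub>m\<close>
  \<open>D\<^sub>m\<^sub>+\<^sub>2 = (a - 2 \<tau> u) D\<^sub>m\<^sub>+\<^sub>1 - \<tau>\<^sup>2 D\<^sub>m\<close> for \<open>m \<ge> 1\<close>.

  The identities \<open>b + \<tau> u = b'\<close> and \<open>\<tau> = u b'\<close> show that \<open>- (b + \<tau> u) \<alpha>\<^sub>1\<close> and \<open>- (b + \<tau> u) \<alpha>\<^sub>2\<close>
  are the two roots of \<open>z\<^sup>2 - (a - 2 \<tau> u) z + \<tau>\<^sup>2\<close>, so the claim is the explicit solution of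
  the recurrence with \<open>D\<^sub>1 = 1\<close> and \<open>D\<^sub>2 = a'\<close>.
  What remains is that the formula does not divide by zero: \<open>b' \<noteq> 0\<close> and the roots are real and
  distinct. Up to positive factors these are the inequalities \<open>w cosh w > sinh w\<close> and
  \<open>sinh w > w\<close> for \<open>w > 0\<close>.
\<close>

section \<open>Determinants of tridiagonal matrices\<close>

text \<open>
  In the last row only two entries survive. The minor of the off-diagonal one has at most one nonzero
  entry in its last column, which leaves the determinant with two rows and columns fewer.
\<close>

lemma det_tridiagonal_recurrence:
  fixes t :: "nat \<Rightarrow> nat \<Rightarrow> 'a :: comm_ring_1"
  assumes below: "\<And>i j. j + 2 \<le> i \<Longrightarrow> t i j = 0"
    and above: "\<And>i j. i + 2 \<le> j \<Longrightarrow> t i j = 0"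
  shows "det (mat (m + 2) (m + 2) (\<lambda>(i, j). t i j)) =
    t (m + 1) (m + 1) * det (mat (m + 1) (m + 1) (\<lambda>(i, j). t i j))
      - t (m + 1) m * t m (m + 1) * det (mat m m (\<lambda>(i, j). t i j))"
proof -
  define T where "T k = mat k k (\<lambda>(i, j). t i j)" for k
  have car: "T k \<in> carrier_mat k k" for k
    by (simp add: T_def)
  define N where "N = mat_delete (T (m + 2)) (m + 1) m"
  have N_car: "N \<in> carrier_mat (m + 1) (m + 1)"
    by (simp add: N_def T_def mat_delete_def)
  have N_col: "N $$ (i, m) = t i (m + 1)" if "i \<le> m" for i
    using that by (simp add: N_def T_def mat_delete_def)
  have N_del: "mat_delete N m m = T m"
    by (rule eq_matI) (auto simp: N_def T_def mat_delete_def)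
  have T_del: "mat_delete (T (m + 2)) (m + 1) (m + 1) = T (m + 1)"
    by (rule eq_matI) (auto simp: T_def mat_delete_def)
  have "det N = (\<Sum>i<m + 1. N $$ (i, m) * cofactor N i m)"
    by (rule laplace_expansion_column[OF N_car]) simp
  also have "\<dots> = (\<Sum>i<m. N $$ (i, m) * cofactor N i m) + N $$ (m, m) * cofactor N m m"
    by simp
  also have "(\<Sum>i<m. N $$ (i, m) * cofactor N i m) = 0"
    by (rule sum.neutral) (auto simp: N_col above)
  also have "cofactor N m m = det (T m)"
    by (simp add: cofactor_def N_del flip: mult_2)
  finally have det_N: "det N = t m (m + 1) * det (T m)"
    by (simp add: N_col)
  have "det (T (m + 2)) = (\<Sum>j<m + 2. T (m + 2) $$ (m + 1, j) * cofactor (T (m + 2)) (m + 1) j)"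
    by (rule laplace_expansion_row[OF car]) simp
  also have "\<dots> = (\<Sum>j<m. T (m + 2) $$ (m + 1, j) * cofactor (T (m + 2)) (m + 1) j)
      + T (m + 2) $$ (m + 1, m) * cofactor (T (m + 2)) (m + 1) m
      + T (m + 2) $$ (m + 1, m + 1) * cofactor (T (m + 2)) (m + 1) (m + 1)"
    by (simp add: numeral_2_eq_2)
  also have "(\<Sum>j<m. T (m + 2) $$ (m + 1, j) * cofactor (T (m + 2)) (m + 1) j) = 0"
    by (rule sum.neutral) (auto simp: T_def below)
  also have "cofactor (T (m + 2)) (m + 1) m = - det N"
    by (simp add: cofactor_def N_def flip: mult_2)
  also have "cofactor (T (m + 2)) (m + 1) (m + 1) = det (T (m + 1))"
    unfolding cofactor_def T_del by (simp flip: mult_2)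
  finally show ?thesis
    unfolding det_N T_def[symmetric] by (simp add: T_def algebra_simps)
qed

lemma det_2x2:
  "det (mat 2 2 (\<lambda>(i, j). t i j)) = t 0 0 * t 1 1 - t 0 1 * (t 1 0 :: 'a :: comm_ring_1)"
proof -
  let ?M = "mat 2 2 (\<lambda>(i, j). t i j)"
  have single: "det (mat_delete ?M 0 j) = t 1 (1 - j)" if "j < 2" for j
    using that by (subst det_single) (auto simp: mat_delete_def)
  show ?thesis
    using laplace_expansion_row[of ?M 2 0]
    by (simp add: numeral_2_eq_2 cofactor_def single[unfolded numeral_2_eq_2])
qed

section \<open>Filtering a Toeplitz matrix\<close>

text \<open>
  The innovation of an autoregression of order two. The first two values have no two predecessors
  and are kept; this is what makes the matrix below lower triangular with unit diagonal.
\<close>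

definition ar_filter :: "'a \<Rightarrow> 'a \<Rightarrow> (nat \<Rightarrow> 'a) \<Rightarrow> nat \<Rightarrow> 'a :: comm_ring_1" where
  "ar_filter p q h i = (if i < 2 then h i else h i - p * h (i - 1) - q * h (i - 2))"

definition ar_mat :: "'a \<Rightarrow> 'a \<Rightarrow> nat \<Rightarrow> 'a :: comm_ring_1 mat" where
  "ar_mat p q m = mat m m (\<lambda>(i, k).
     if k = i then 1 else if 2 \<le> i \<and> k = i - 1 then - p else if 2 \<le> i \<and> k = i - 2 then - q else 0)"

lemma ar_mat_carrier: "ar_mat p q m \<in> carrier_mat m m"
  by (simp add: ar_mat_def)

lemma det_ar_mat: "det (ar_mat p q m) = 1"
proof -
  have "det (ar_mat p q m) = prod_list (diag_mat (ar_mat p q m))"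
    by (rule det_lower_triangular[OF _ ar_mat_carrier]) (auto simp: ar_mat_def)
  also have "\<dots> = 1"
    by (simp add: prod_list_diag_prod ar_mat_def)
  finally show ?thesis .
qed

lemma sum_ar_mat:
  assumes "i < m"
  shows "(\<Sum>k = 0..<m. ar_mat p q m $$ (i, k) * h k) = ar_filter p q h i"
proof (cases "i < 2")
  case True
  have "(\<Sum>k = 0..<m. ar_mat p q m $$ (i, k) * h k) = (\<Sum>k = 0..<m. if k = i then h k else 0)"
    by (rule sum.cong) (use assms True in \<open>auto simp: ar_mat_def\<close>)
  then show ?thesis
    using assms True by (simp add: ar_filter_def)
next
  case False
  have "(\<Sum>k = 0..<m. ar_mat p q m $$ (i, k) * h k) =
      (\<Sum>k = 0..<m. (if k = i then h k else 0) + (if k = i - 1 then - p * h k else 0)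
        + (if k = i - 2 then - q * h k else 0))"
    by (rule sum.cong) (use assms False in \<open>auto simp: ar_mat_def\<close>)
  also have "\<dots> = h i - p * h (i - 1) - q * h (i - 2)"
    using assms less_imp_diff_less[OF assms] by (simp add: sum.distrib)
  finally show ?thesis
    using False by (simp add: ar_filter_def)
qed

text \<open>
  Filtering both indices of \<open>c\<close> is the congruence \<open>L C L\<^sup>T\<close> with \<open>det L = 1\<close>.
\<close>

lemma det_ar_filter:
  "det (mat m m (\<lambda>(i, j). ar_filter p q (\<lambda>k. ar_filter p q (c k) j) i)) =
    det (mat m m (\<lambda>(i, j). c i j))"
proof -
  let ?L = "ar_mat p q m" and ?C = "mat m m (\<lambda>(i, j). c i j)"
  note [simp] = carrier_matD[OF ar_mat_carrier]
  have R: "?C * ?L\<^sup>T = mat m m (\<lambda>(i, j). ar_filter p q (c i) j)" (is "_ = ?R")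
  proof (rule eq_matI)
    fix i j assume "i < dim_row ?R" "j < dim_col ?R"
    then have ij: "i < m" "j < m" by auto
    then have "(?C * ?L\<^sup>T) $$ (i, j) = (\<Sum>k = 0..<m. ?L $$ (j, k) * c i k)"
      by (simp add: scalar_prod_def mult.commute)
    with ij show "(?C * ?L\<^sup>T) $$ (i, j) = ?R $$ (i, j)"
      by (simp add: sum_ar_mat)
  qed auto
  have L: "?L * ?R = mat m m (\<lambda>(i, j). ar_filter p q (\<lambda>k. ar_filter p q (c k) j) i)" (is "_ = ?T")
  proof (rule eq_matI)
    fix i j assume "i < dim_row ?T" "j < dim_col ?T"
    then have ij: "i < m" "j < m" by auto
    then have "(?L * ?R) $$ (i, j) = (\<Sum>k = 0..<m. ?L $$ (i, k) * ar_filter p q (c k) j)"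
      by (simp add: scalar_prod_def)
    with ij show "(?L * ?R) $$ (i, j) = ?T $$ (i, j)"
      by (simp add: sum_ar_mat)
  qed auto
  have "det ?T = det ?L * det ?R"
    unfolding L[symmetric] by (rule det_mult[OF ar_mat_carrier]) simp
  also have "det ?R = det ?C * det ?L"
    unfolding R[symmetric]
    using det_mult[of ?C m "?L\<^sup>T"] transpose_carrier_mat[of ?L m m] ar_mat_carrier[of p q m]
    by (simp add: det_transpose[OF ar_mat_carrier])
  finally show ?thesis
    by (simp add: det_ar_mat)
qed

definition toeplitz :: "(nat \<Rightarrow> 'a) \<Rightarrow> nat \<Rightarrow> nat \<Rightarrow> 'a" where
  "toeplitz f i j = f (nat \<bar>int i - int j\<bar>)"

lemma toeplitz_commute: "toeplitz f i j = toeplitz f j i"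
  by (simp add: toeplitz_def abs_minus_commute)

lemma toeplitz_add [simp]: "toeplitz f (j + d) j = f d" "toeplitz f j (j + d) = f d"
  by (simp_all add: toeplitz_def)

lemma ar_filter_toeplitz_swap:
  "ar_filter p q (\<lambda>k. ar_filter p q (toeplitz f k) j) i =
   ar_filter p q (\<lambda>k. ar_filter p q (toeplitz f k) i) j"
  by (simp add: ar_filter_def toeplitz_commute[of f i] toeplitz_commute[of f "i - Suc 0"]
      toeplitz_commute[of f "i - 2"] algebra_simps)

text \<open>
  If the symbol of the matrix solves the recurrence defining the filter, then filtering one index
  kills every entry at distance at least two below the diagonal, and filtering the other index
  preserves this; by symmetry the result is tridiagonal. From the third row on
  the row index is filtered, and the subdiagonal entry is \<open>\<tau>\<close>, the diagonal one \<open>\<sigma> - p \<tau>\<close>. The first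
  two rows have other entries, so the recurrence starts from the determinants of sizes 1 and 2.
\<close>

lemma det_toeplitz_recurrence:
  fixes f :: "nat \<Rightarrow> 'a :: comm_ring_1"
  assumes rec: "\<And>d. f (d + 2) = p * f (d + 1) + q * f d"
  defines "\<tau> \<equiv> f 1 - p * f 0 - q * f 1"
  defines "\<sigma> \<equiv> f 0 - p * f 1 - q * f 2"
  defines "D \<equiv> \<lambda>m. det (mat m m (\<lambda>(i, j). toeplitz f i j))"
  shows "D (m + 3) = (\<sigma> - p * \<tau>) * D (m + 2) - \<tau>\<^sup>2 * D (m + 1)"
proof -
  define g where "g i j = ar_filter p q (\<lambda>k. toeplitz f k j) i" for i j
  define t where "t i j = ar_filter p q (\<lambda>k. ar_filter p q (toeplitz f k) j) i" for i j
  have t_g: "t i j = ar_filter p q (g i) j" for i j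
    unfolding t_def g_def by (simp add: ar_filter_def algebra_simps)
  \<comment> \<open>The distances \<open>i - j\<close>, \<open>i - 1 - j\<close> and \<open>i - 2 - j\<close> are all nonnegative, so the absolute
    value in the definition of a Toeplitz matrix does not disturb the recurrence.\<close>
  have g_orth: "g i j = 0" if le: "j + 2 \<le> i" for i j
  proof -
    obtain d where i: "i = j + (d + 2)"
      using le by (metis add.assoc add.commute le_iff_add)
    have "i - 1 = j + (d + 1)" "i - 2 = j + d" "\<not> i < 2"
      using i by simp_all
    then show ?thesis
      unfolding g_def ar_filter_def using i rec[of d] by (simp only: toeplitz_add if_False) simp
  qed
  have t_below: "t i j = 0" if "j + 2 \<le> i" for i j
    using that by (simp add: t_g ar_filter_def g_orth)
  have t_swap: "t i j = t j i" for i j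
    unfolding t_def by (rule ar_filter_toeplitz_swap)
  have t_above: "t i j = 0" if "i + 2 \<le> j" for i j
    using t_below[OF that] by (simp add: t_swap)
  have g_sub: "g (k + 2) (k + 1) = \<tau>" for k
    by (simp add: g_def ar_filter_def \<tau>_def toeplitz_def)
  have g_diag: "g (k + 2) (k + 2) = \<sigma>" for k
    by (simp add: g_def ar_filter_def \<sigma>_def toeplitz_def)
  have t_sub: "t (m + 2) (m + 1) = \<tau>"
    using g_sub[of m] g_sub[of 0] by (cases m) (simp_all add: t_g ar_filter_def g_orth)
  have t_diag: "t (m + 2) (m + 2) = \<sigma> - p * \<tau>"
    using g_sub[of m] g_diag[of m] by (simp add: t_g ar_filter_def g_orth)
  have D_t: "D k = det (mat k k (\<lambda>(i, j). t i j))" for k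
    unfolding D_def t_def by (rule det_ar_filter[symmetric])
  show ?thesis
    using det_tridiagonal_recurrence[of t "m + 1", OF t_below t_above] t_sub t_diag
      t_swap[of "m + 1" "m + 2"]
    by (simp add: D_t power2_eq_square numeral_3_eq_3)
qed

section \<open>The closed form\<close>

lemma linear_recurrence_closed_form:
  fixes E :: "nat \<Rightarrow> 'a :: field"
  assumes rec: "\<And>k. E (k + 2) = (x + y) * E (k + 1) - x * y * E k" and "x \<noteq> y"
  shows "E k = ((E 1 - y * E 0) * x ^ k - (E 1 - x * E 0) * y ^ k) / (x - y)"
proof -
  have "(x - y) * E k = (E 1 - y * E 0) * x ^ k - (E 1 - x * E 0) * y ^ k"
  proof (induction k rule: less_induct)
    case (less k)
    consider "k = 0" | "k = 1" | j where "k = j + 2"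
      by (metis One_nat_def add_2_eq_Suc' not0_implies_Suc)
    then show ?case
    proof cases
      case 3
      have "(x - y) * E k = (x + y) * ((x - y) * E (j + 1)) - x * y * ((x - y) * E j)"
        unfolding 3 rec by (simp add: algebra_simps)
      also have "\<dots> = (E 1 - y * E 0) * x ^ k - (E 1 - x * E 0) * y ^ k"
      proof -
        have "j < k" "j + 1 < k"
          using 3 by simp_all
        note IH = less[OF this(1)] less[OF this(2)]
        show ?thesis
          unfolding IH unfolding 3 by (simp add: algebra_simps)
      qed
      finally show ?thesis .
    qed (simp_all add: algebra_simps)
  qed
  with \<open>x \<noteq> y\<close> show ?thesis
    by (simp add: field_simps)
qed

text \<open>This is \<open>sinh w > w\<close>, multiplied by \<open>2 e^{-w}\<close>.\<close>

lemma one_minus_exp_gt: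
  fixes w :: real
  assumes "w > 0"
  shows "2 * exp (- w) * w < 1 - exp (- w) ^ 2"
proof -
  let ?h = "\<lambda>x::real. 1 - exp (- x) ^ 2 - 2 * exp (- x) * x"
  have "?h 0 < ?h w"
  proof (rule DERIV_pos_imp_increasing_open[OF assms])
    fix x :: real assume "0 < x" "x < w"
    have "(?h has_real_derivative 2 * exp (- x) * (exp (- x) - (1 - x))) (at x)"
      by (auto intro!: derivative_eq_intros simp: algebra_simps power2_eq_square)
    moreover have "1 - x < exp (- x)"
      using \<open>0 < x\<close> by (simp add: exp_minus_greater)
    ultimately show "\<exists>y. (?h has_real_derivative y) (at x) \<and> 0 < y"
      by fastforce
  qed (auto intro!: continuous_intros)
  then show ?thesis
    by simp
qed

text \<open>This is \<open>w cosh w > sinh w\<close>, multiplied by \<open>2 e^{-w}\<close>.\<close>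

lemma one_minus_exp_lt:
  fixes w :: real
  assumes "w > 0"
  shows "1 - exp (- w) ^ 2 < w * (1 + exp (- w) ^ 2)"
proof -
  let ?h = "\<lambda>x::real. x * (1 + exp (- 2 * x)) - (1 - exp (- 2 * x))"
  have "?h 0 < ?h w"
  proof (rule DERIV_pos_imp_increasing_open[OF assms])
    fix x :: real assume "0 < x" "x < w"
    have "(?h has_real_derivative 1 - exp (- 2 * x) * (1 + 2 * x)) (at x)"
      by (auto intro!: derivative_eq_intros simp: algebra_simps)
    moreover have "1 + 2 * x < exp (2 * x)"
      using exp_minus_greater[of "- 2 * x"] \<open>0 < x\<close> by simp
    then have "exp (- 2 * x) * (1 + 2 * x) < exp (- 2 * x) * exp (2 * x)"
      by simp
    then have "exp (- 2 * x) * (1 + 2 * x) < 1"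
      by (simp flip: exp_add)
    ultimately show "\<exists>y. (?h has_real_derivative y) (at x) \<and> 0 < y"
      by (smt (verit))
  qed (auto intro!: continuous_intros)
  then show ?thesis
    by (simp add: exp_double[symmetric])
qed

theorem theorem1:
  fixes n m :: nat
    and \<theta> w u \<tau> a b a' b' \<alpha>\<^sub>1 \<alpha>\<^sub>2 :: real
  assumes "n \<ge> 1" and "\<theta> > 0"
    and "2 \<le> m" and "m \<le> n"
    and "w = \<theta> / real n"
    and "u = exp (- w)"
    and "\<tau> = (w - 1) * u + (1 + w) * u ^ 3"
    and "a = 1 - 2 * u ^ 2 + u ^ 4 - 2 * u ^ 2 * w + 2 * u ^ 4 * w"
    and "b = 2 * u ^ 2 - u ^ 4 + w - u ^ 4 * w - 1"
    and "a' = 1 - u ^ 2 - 2 * u ^ 2 * w - u ^ 2 * w ^ 2"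
    and "b' = u ^ 2 + w + u ^ 2 * w - 1"
    and "\<alpha>\<^sub>1 = (- (a - 2 * \<tau> * u) - sqrt ((a - 2 * \<tau> * u) ^ 2 - 4 * \<tau> * u * (b + \<tau> * u)))
              / (2 * (b + \<tau> * u))"
    and "\<alpha>\<^sub>2 = (- (a - 2 * \<tau> * u) + sqrt ((a - 2 * \<tau> * u) ^ 2 - 4 * \<tau> * u * (b + \<tau> * u)))
              / (2 * (b + \<tau> * u))"
  shows "det (R_mat \<theta> n m) =
    ((a' * \<alpha>\<^sub>1 + u ^ 2 * b') * (- (b + \<tau> * u) * \<alpha>\<^sub>1) ^ (m - 2)
      - (a' * \<alpha>\<^sub>2 + u ^ 2 * b') * (- (b + \<tau> * u) * \<alpha>\<^sub>2) ^ (m - 2)) / (\<alpha>\<^sub>1 - \<alpha>\<^sub>2)"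
proof -
  have "w > 0"
    using assms by simp
  then have u: "0 < u" "u < 1"
    using \<open>u = exp (- w)\<close> by simp_all
  define c where "c = a - 2 * \<tau> * u"
  define s where "s = sqrt (c\<^sup>2 - 4 * \<tau> * u * (b + \<tau> * u))"
  have b': "b + \<tau> * u = b'"
    unfolding assms(7,9,11)
    by (simp add: algebra_simps power2_eq_square power3_eq_cube power4_eq_xxxx)
  have \<tau>: "\<tau> = u * b'"
    unfolding assms(7,11)
    by (simp add: algebra_simps power2_eq_square power3_eq_cube power4_eq_xxxx)
  have "b' > 0"
    using one_minus_exp_lt[OF \<open>w > 0\<close>] by (simp add: assms(6,11) algebra_simps)
  \<comment> \<open>The discriminant is \<open>c\<^sup>2 - (2 u b')\<^sup>2\<close>, so its sign follows from \<open>c > 2 u b' > 0\<close>.\<close>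
  have "c - 2 * u * b' = (1 + u)\<^sup>2 * (1 - u\<^sup>2 - 2 * u * w)"
    unfolding c_def assms(7,8,11)
    by (simp add: algebra_simps power2_eq_square power3_eq_cube power4_eq_xxxx)
  moreover have "1 - u\<^sup>2 - 2 * u * w > 0"
    using one_minus_exp_gt[OF \<open>w > 0\<close>] by (simp add: assms(6))
  ultimately have "c > 2 * u * b'"
    using u zero_less_mult_iff[of "(1 + u)\<^sup>2"] by (smt (verit) zero_less_power)
  then have "(2 * u * b')\<^sup>2 < c\<^sup>2"
    using u \<open>b' > 0\<close> by (intro power_strict_mono) auto
  moreover have disc: "c\<^sup>2 - 4 * \<tau> * u * (b + \<tau> * u) = c\<^sup>2 - (2 * u * b')\<^sup>2"
    unfolding b' unfolding \<tau> by (simp add: algebra_simps power2_eq_square power3_eq_cube power4_eq_xxxx)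
  ultimately have "s > 0"
    by (simp add: s_def)
  have s2: "s\<^sup>2 = c\<^sup>2 - (2 * u * b')\<^sup>2"
    using \<open>s > 0\<close> unfolding s_def disc by (simp add: not_le)
  \<comment> \<open>Scaling the \<open>\<alpha>\<close>'s removes the division and turns them into the characteristic roots.\<close>
  define x where "x = - (b + \<tau> * u) * \<alpha>\<^sub>1"
  define y where "y = - (b + \<tau> * u) * \<alpha>\<^sub>2"
  have x: "x = (c + s) / 2" and y: "y = (c - s) / 2"
    unfolding x_def y_def assms(12,13) c_def[symmetric] s_def[symmetric] unfolding b'
    using \<open>b' > 0\<close> by (simp_all add: field_simps)
  have sum_xy: "x + y = c" and prod_xy: "x * y = \<tau>\<^sup>2" and "x \<noteq> y"
    using \<open>s > 0\<close> s2 by (auto simp: x y \<tau> power2_eq_square field_simps)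

  define f where "f d = (1 + real d * w) * u ^ d" for d
  define D where "D k = det (R_mat \<theta> n k)" for k
  have D: "D k = det (mat k k (\<lambda>(i, j). toeplitz f i j))" for k
    by (simp add: D_def R_mat_def toeplitz_def f_def Let_def flip: assms(5,6))
  have f_rec: "f (d + 2) = (2 * u) * f (d + 1) + (- (u\<^sup>2)) * f d" for d
    by (simp add: f_def algebra_simps power2_eq_square)
  have f_\<tau>: "f 1 - (2 * u) * f 0 - (- (u\<^sup>2)) * f 1 = \<tau>"
    unfolding assms(7) by (simp add: f_def algebra_simps power2_eq_square power3_eq_cube)
  have f_\<sigma>: "f 0 - (2 * u) * f 1 - (- (u\<^sup>2)) * f 2 - (2 * u) * \<tau> = c"
    unfolding c_def assms(8) by (simp add: f_def algebra_simps power2_eq_square power4_eq_xxxx)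
  have D_rec: "D (k + 3) = (x + y) * D (k + 2) - x * y * D (k + 1)" for k
    using det_toeplitz_recurrence[of f "2 * u" "- (u\<^sup>2)" k, OF f_rec]
    unfolding f_\<tau> f_\<sigma> D sum_xy prod_xy .
  have D1: "D 1 = 1"
    unfolding D by (subst det_single) (simp_all add: toeplitz_def f_def)
  have D2: "D 2 = a'"
    unfolding D det_2x2 assms(10)
    by (simp add: toeplitz_def f_def algebra_simps power2_eq_square)
  have D3: "D 3 = (x + y) * a' - x * y"
    using D_rec[of 0] D1 D2 by (simp add: numeral_2_eq_2)
  have "D m = ((D 3 - y * D 2) * x ^ (m - 2) - (D 3 - x * D 2) * y ^ (m - 2)) / (x - y)"
  proof -
    have "D (k + 2 + 2) = (x + y) * D (k + 1 + 2) - x * y * D (k + 2)" for k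
      using D_rec[of "k + 1"] by (simp add: numeral_3_eq_3)
    then show ?thesis
      using linear_recurrence_closed_form[of "\<lambda>k. D (k + 2)" x y "m - 2"] \<open>x \<noteq> y\<close> \<open>2 \<le> m\<close>
      by (simp del: add_2_eq_Suc')
  qed
  \<comment> \<open>The numerators and the denominator share the factor \<open>- b'\<close>, which then cancels.\<close>
  also have "D 3 - y * D 2 = - b' * (a' * \<alpha>\<^sub>1 + u\<^sup>2 * b')"
    unfolding D3 D2 prod_xy \<tau> by (simp add: x_def b' algebra_simps power2_eq_square)
  also have "D 3 - x * D 2 = - b' * (a' * \<alpha>\<^sub>2 + u\<^sup>2 * b')"
    unfolding D3 D2 prod_xy \<tau> by (simp add: y_def b' algebra_simps power2_eq_square)
  also have "x - y = - b' * (\<alpha>\<^sub>1 - \<alpha>\<^sub>2)"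
    by (simp add: x_def y_def b' algebra_simps)
  finally have "D m = (- b' * ((a' * \<alpha>\<^sub>1 + u\<^sup>2 * b') * x ^ (m - 2) - (a' * \<alpha>\<^sub>2 + u\<^sup>2 * b') * y ^ (m - 2)))
      / (- b' * (\<alpha>\<^sub>1 - \<alpha>\<^sub>2))"
    by (simp add: algebra_simps)
  then show ?thesis
    using \<open>b' > 0\<close> by (simp add: D_def x_def y_def)
qed

end
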